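(* Let $A$ be a Banach algebra and $X$ a faithful, topologically (left and right) introverted subspace of $A^*$. (i) If there is a $w^*$-continuous, injective anti-homomorphism $\Theta\colon X^*\to X^*$ (with respect to either of the Arens products $\Box$, $\Diamond$) such that $\Theta(A)\subset A$, then the two Arens products coincide on $X^*$. (ii) Let $\theta\colon A\to A$ be an involution on $A$ and let $\theta^*\colon A^*\to A^*$ be its conjugate-linear adjoint. If $\theta^*(X)\subset X$ and if the two Arens products coincide on $X^*$, then $\Theta=(\theta^*|_X)^*\colon X^*\to X^*$ is an involution on $X^*$ extending $\theta$.
   Context: For a Banach algebra $A$, $\lambda\in A^*$ and $a,b\in A$, put $\langle\lambda\cdot a,b\rangle=\langle\lambda,ab\rangle$ and $\langle a\cdot\lambda,b\rangle=\langle\lambda,ba\rangle$. Let $X\subset A^*$ be a norm closed $A$-submodule (under both actions). For $\Psi\in X^*$, $\lambda\in X$ define $\Psi\cdot\lambda,\ \lambda\cdot\Psi\in A^*$ by $\langle\Psi\cdot\lambda,a\rangle=\langle\Psi,\lambda\cdot a\rangle$ and $\langle\lambda\cdot\Psi,a\rangle=\langle\Psi,a\cdot\lambda\rangle$. $X$ is topologically left (resp. right) introverted if $\Psi\cdot\lambda\in X$ (resp. $\lambda\cdot\Psi\in X$) for all $\Psi\in X^*$, $\lambda\in X$; it is topologically introverted if it is both. The first and second Arens products on $X^*$ are $\langle\Phi\Box\Psi,\lambda\rangle=\langle\Phi,\Psi\cdot\lambda\rangle$ and $\langle\Phi\Diamond\Psi,\lambda\rangle=\langle\Psi,\lambda\cdot\Phi\rangle$;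 each makes $X^*$ a Banach algebra. $X$ is faithful if $a\in A$ and $\lambda(a)=0$ for all $\lambda\in X$ imply $a=0$; then the natural map $A\to X^*$ is injective and $A$ is regarded as a subalgebra of $X^*$. An anti-homomorphism reverses products; an involution is a conjugate-linear anti-homomorphism whose square is the identity. Involutions $\theta$ on $A$ are taken bounded, so that the conjugate-linear adjoint $\theta^*\colon A^*\to A^*$, $\langle\theta^*(f),a\rangle=\overline{\langle f,\theta(a)\rangle}$, is defined; similarly $\langle(\theta^*|_X)^*(\Phi),\lambda\rangle=\overline{\langle\Phi,\theta^*(\lambda)\rangle}$ for $\Phi\in X^*$, $\lambda\in X$. *)

theory Defs
  imports "HOL-Analysis.Analysis"
begin

section \<open>Complex Banach algebras and their duals\<close>

text \<open>
  Algebras need not have a unit. The library classes provide the real Banach algebra structure;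
  the class below adds a compatible complex scalar multiplication.
\<close>

class complex_banach_algebra = banach + real_normed_algebra +
  fixes scaleC :: "complex \<Rightarrow> 'a \<Rightarrow> 'a"  (infixr \<open>*\<^sub>C\<close> 75)
  assumes scaleC_of_real: "complex_of_real r *\<^sub>C x = r *\<^sub>R x"
    and scaleC_add_right: "c *\<^sub>C (x + y) = c *\<^sub>C x + c *\<^sub>C y"
    and scaleC_add_left: "(c + d) *\<^sub>C x = c *\<^sub>C x + d *\<^sub>C x"
    and scaleC_scaleC: "c *\<^sub>C (d *\<^sub>C x) = (c * d) *\<^sub>C x"
    and mult_scaleC_left: "(c *\<^sub>C x) * y = c *\<^sub>C (x * y)"
    and mult_scaleC_right: "x * (c *\<^sub>C y) = c *\<^sub>C (x * y)"
    and norm_scaleC: "norm (c *\<^sub>C x) = cmod c * norm x"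

text \<open>
  The type \<open>'a \<Rightarrow>\<^sub>L complex\<close> consists of the bounded real-linear maps. The dual \<open>A\<^sup>*\<close> is the closed
  subspace of complex-linear ones, with the norm of that type.
\<close>

definition dual :: "('a::complex_banach_algebra \<Rightarrow>\<^sub>L complex) set" where
  "dual = {f. \<forall>c a. blinfun_apply f (c *\<^sub>C a) = c * blinfun_apply f a}"

definition cscale :: "complex \<Rightarrow> ('a::complex_banach_algebra \<Rightarrow>\<^sub>L complex) \<Rightarrow> ('a \<Rightarrow>\<^sub>L complex)" where
  "cscale c f = blinfun_mult_right c o\<^sub>L f"

text \<open>The module actions \<open>\<lambda> \<cdot> a\<close> and \<open>a \<cdot> \<lambda>\<close>; see the lemmas \<open>act_apply\<close> below.\<close>

definition ract :: "('a::complex_banach_algebra \<Rightarrow>\<^sub>L complex) \<Rightarrow> 'a \<Rightarrow> ('a \<Rightarrow>\<^sub>L complex)" where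
  "ract l a = l o\<^sub>L blinfun_mult_right a"

definition lact :: "'a::complex_banach_algebra \<Rightarrow> ('a \<Rightarrow>\<^sub>L complex) \<Rightarrow> ('a \<Rightarrow>\<^sub>L complex)" where
  "lact a l = l o\<^sub>L blinfun_mult_left a"

lemma act_apply:
  "blinfun_apply (ract l a) b = blinfun_apply l (a * b)"
  "blinfun_apply (lact a l) b = blinfun_apply l (b * a)"
  "blinfun_apply (cscale c l) b = c * blinfun_apply l b"
  by (simp_all add: ract_def lact_def cscale_def)

definition closed_submodule :: "('a::complex_banach_algebra \<Rightarrow>\<^sub>L complex) set \<Rightarrow> bool" where
  "closed_submodule X \<longleftrightarrow>
     X \<subseteq> dual \<and> 0 \<in> X \<and> (\<forall>l\<in>X. \<forall>m\<in>X. l + m \<in> X) \<and> (\<forall>c. \<forall>l\<in>X. cscale c l \<in> X) \<and>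
     closed X \<and> (\<forall>a. \<forall>l\<in>X. ract l a \<in> X \<and> lact a l \<in> X)"

definition faithful :: "('a::complex_banach_algebra \<Rightarrow>\<^sub>L complex) set \<Rightarrow> bool" where
  "faithful X \<longleftrightarrow> (\<forall>a. (\<forall>l\<in>X. blinfun_apply l a = 0) \<longrightarrow> a = 0)"

section \<open>The dual of a submodule\<close>

text \<open>
  \<open>X\<^sup>*\<close> is a set of functions on the carrier \<open>X\<close>. They are taken extensional (equal to
  \<open>undefined\<close> off \<open>X\<close>), so that equality in HOL is equality of functionals on \<open>X\<close>.
\<close>

definition sdual ::
  "('a::complex_banach_algebra \<Rightarrow>\<^sub>L complex) set \<Rightarrow> (('a \<Rightarrow>\<^sub>L complex) \<Rightarrow> complex) set" where
  "sdual X = {\<Phi> \<in> extensional X.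
     (\<forall>l\<in>X. \<forall>m\<in>X. \<Phi> (l + m) = \<Phi> l + \<Phi> m) \<and>
     (\<forall>c. \<forall>l\<in>X. \<Phi> (cscale c l) = c * \<Phi> l) \<and>
     (\<exists>K. \<forall>l\<in>X. cmod (\<Phi> l) \<le> K * norm l)}"

definition sdual_add :: "('a::complex_banach_algebra \<Rightarrow>\<^sub>L complex) set \<Rightarrow>
    (('a \<Rightarrow>\<^sub>L complex) \<Rightarrow> complex) \<Rightarrow> (('a \<Rightarrow>\<^sub>L complex) \<Rightarrow> complex) \<Rightarrow> (('a \<Rightarrow>\<^sub>L complex) \<Rightarrow> complex)" where
  "sdual_add X \<Phi> \<Psi> = (\<lambda>l\<in>X. \<Phi> l + \<Psi> l)"

definition sdual_scale :: "('a::complex_banach_algebra \<Rightarrow>\<^sub>L complex) set \<Rightarrow>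
    complex \<Rightarrow> (('a \<Rightarrow>\<^sub>L complex) \<Rightarrow> complex) \<Rightarrow> (('a \<Rightarrow>\<^sub>L complex) \<Rightarrow> complex)" where
  "sdual_scale X c \<Phi> = (\<lambda>l\<in>X. c * \<Phi> l)"

definition natural_map :: "('a::complex_banach_algebra \<Rightarrow>\<^sub>L complex) set \<Rightarrow>
    'a \<Rightarrow> (('a \<Rightarrow>\<^sub>L complex) \<Rightarrow> complex)" where
  "natural_map X a = (\<lambda>l\<in>X. blinfun_apply l a)"

text \<open>The \<open>w\<^sup>*\<close>-topology \<open>\<sigma>(X\<^sup>*, X)\<close>: pointwise convergence on \<open>X\<close>.\<close>

definition weak_star :: "('a::complex_banach_algebra \<Rightarrow>\<^sub>L complex) set \<Rightarrow>
    (('a \<Rightarrow>\<^sub>L complex) \<Rightarrow> complex) topology" where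
  "weak_star X = subtopology (product_topology (\<lambda>_. euclidean) X) (sdual X)"

section \<open>Introversion and the Arens products\<close>

text \<open>
  \<open>\<Psi> \<cdot> \<lambda>\<close> and \<open>\<lambda> \<cdot> \<Psi>\<close>. For \<open>\<Psi> \<in> X\<^sup>*\<close> and \<open>\<lambda> \<in> X\<close> the argument of \<open>Blinfun\<close> is a bounded linear map;
  see \<open>dual_act_apply\<close> below.
\<close>

definition dlact :: "(('a::complex_banach_algebra \<Rightarrow>\<^sub>L complex) \<Rightarrow> complex) \<Rightarrow>
    ('a \<Rightarrow>\<^sub>L complex) \<Rightarrow> ('a \<Rightarrow>\<^sub>L complex)" where
  "dlact \<Psi> l = Blinfun (\<lambda>a. \<Psi> (ract l a))"

definition dract :: "('a::complex_banach_algebra \<Rightarrow>\<^sub>L complex) \<Rightarrow>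
    (('a \<Rightarrow>\<^sub>L complex) \<Rightarrow> complex) \<Rightarrow> ('a \<Rightarrow>\<^sub>L complex)" where
  "dract l \<Psi> = Blinfun (\<lambda>a. \<Psi> (lact a l))"

definition topologically_left_introverted :: "('a::complex_banach_algebra \<Rightarrow>\<^sub>L complex) set \<Rightarrow> bool" where
  "topologically_left_introverted X \<longleftrightarrow> (\<forall>\<Psi>\<in>sdual X. \<forall>l\<in>X. dlact \<Psi> l \<in> X)"

definition topologically_right_introverted :: "('a::complex_banach_algebra \<Rightarrow>\<^sub>L complex) set \<Rightarrow> bool" where
  "topologically_right_introverted X \<longleftrightarrow> (\<forall>\<Psi>\<in>sdual X. \<forall>l\<in>X. dract l \<Psi> \<in> X)"

definition topologically_introverted :: "('a::complex_banach_algebra \<Rightarrow>\<^sub>L complex) set \<Rightarrow> bool" where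
  "topologically_introverted X \<longleftrightarrow>
     topologically_left_introverted X \<and> topologically_right_introverted X"

definition arens1 :: "('a::complex_banach_algebra \<Rightarrow>\<^sub>L complex) set \<Rightarrow>
    (('a \<Rightarrow>\<^sub>L complex) \<Rightarrow> complex) \<Rightarrow> (('a \<Rightarrow>\<^sub>L complex) \<Rightarrow> complex) \<Rightarrow> (('a \<Rightarrow>\<^sub>L complex) \<Rightarrow> complex)" where
  "arens1 X \<Phi> \<Psi> = (\<lambda>l\<in>X. \<Phi> (dlact \<Psi> l))"

definition arens2 :: "('a::complex_banach_algebra \<Rightarrow>\<^sub>L complex) set \<Rightarrow>
    (('a \<Rightarrow>\<^sub>L complex) \<Rightarrow> complex) \<Rightarrow> (('a \<Rightarrow>\<^sub>L complex) \<Rightarrow> complex) \<Rightarrow> (('a \<Rightarrow>\<^sub>L complex) \<Rightarrow> complex)" where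
  "arens2 X \<Phi> \<Psi> = (\<lambda>l\<in>X. \<Psi> (dract l \<Phi>))"

definition arens_products_coincide :: "('a::complex_banach_algebra \<Rightarrow>\<^sub>L complex) set \<Rightarrow> bool" where
  "arens_products_coincide X \<longleftrightarrow> (\<forall>\<Phi>\<in>sdual X. \<forall>\<Psi>\<in>sdual X. arens1 X \<Phi> \<Psi> = arens2 X \<Phi> \<Psi>)"

section \<open>Anti-homomorphisms and involutions\<close>

text \<open>
  An anti-homomorphism is only required to reverse products, since both linear and
  conjugate-linear ones occur.
\<close>

definition anti_hom_on :: "'v set \<Rightarrow> ('v \<Rightarrow> 'v \<Rightarrow> 'v) \<Rightarrow> ('v \<Rightarrow> 'v) \<Rightarrow> bool" where
  "anti_hom_on S mul f \<longleftrightarrow> f ` S \<subseteq> S \<and> (\<forall>x\<in>S. \<forall>y\<in>S. f (mul x y) = mul (f y) (f x))"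

definition involution_on :: "'v set \<Rightarrow> ('v \<Rightarrow> 'v \<Rightarrow> 'v) \<Rightarrow> (complex \<Rightarrow> 'v \<Rightarrow> 'v) \<Rightarrow>
    ('v \<Rightarrow> 'v \<Rightarrow> 'v) \<Rightarrow> ('v \<Rightarrow> 'v) \<Rightarrow> bool" where
  "involution_on S add smul mul f \<longleftrightarrow>
     anti_hom_on S mul f \<and>
     (\<forall>x\<in>S. \<forall>y\<in>S. f (add x y) = add (f x) (f y)) \<and>
     (\<forall>c. \<forall>x\<in>S. f (smul c x) = smul (cnj c) (f x)) \<and>
     (\<forall>x\<in>S. f (f x) = x)"

text \<open>
  The conjugate-linear adjoint \<open>\<theta>\<^sup>*\<close> of a bounded map on \<open>A\<close>, and the conjugate-linear adjoint
  of the restriction to \<open>X\<close> of a map \<open>T\<close> on \<open>A\<^sup>*\<close> with \<open>T(X) \<subseteq> X\<close>.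
\<close>

definition conj_adjoint :: "('a::complex_banach_algebra \<Rightarrow> 'a) \<Rightarrow>
    ('a \<Rightarrow>\<^sub>L complex) \<Rightarrow> ('a \<Rightarrow>\<^sub>L complex)" where
  "conj_adjoint \<theta> f = Blinfun (\<lambda>a. cnj (blinfun_apply f (\<theta> a)))"

definition conj_adjoint_restr :: "('a::complex_banach_algebra \<Rightarrow>\<^sub>L complex) set \<Rightarrow>
    (('a \<Rightarrow>\<^sub>L complex) \<Rightarrow> ('a \<Rightarrow>\<^sub>L complex)) \<Rightarrow>
    (('a \<Rightarrow>\<^sub>L complex) \<Rightarrow> complex) \<Rightarrow> (('a \<Rightarrow>\<^sub>L complex) \<Rightarrow> complex)" where
  "conj_adjoint_restr X T \<Phi> = (\<lambda>l\<in>X. cnj (\<Phi> (T l)))"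

lemma scaleR_eq_cscale: "r *\<^sub>R l = cscale (complex_of_real r) l"
  by (rule blinfun_eqI) (simp add: act_apply scaleR_blinfun.rep_eq scaleR_conv_of_real)

lemma sdual_bound:
  assumes "\<Psi> \<in> sdual X"
  obtains K where "K \<ge> 0" "\<And>l. l \<in> X \<Longrightarrow> cmod (\<Psi> l) \<le> K * norm l"
proof -
  from assms obtain K where K: "\<And>l. l \<in> X \<Longrightarrow> cmod (\<Psi> l) \<le> K * norm l"
    unfolding sdual_def by blast
  show ?thesis
  proof (rule that[of "\<bar>K\<bar>"])
    fix l assume "l \<in> X"
    have "K * norm l \<le> \<bar>K\<bar> * norm l" by (simp add: mult_right_mono)
    with K[OF \<open>l \<in> X\<close>] show "cmod (\<Psi> l) \<le> \<bar>K\<bar> * norm l" by linarith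
  qed simp
qed

lemma dual_act_apply:
  assumes "closed_submodule X" "\<Psi> \<in> sdual X" "l \<in> X"
  shows "blinfun_apply (dlact \<Psi> l) a = \<Psi> (ract l a)"
    and "blinfun_apply (dract l \<Psi>) a = \<Psi> (lact a l)"
proof -
  have add: "\<And>x y. x \<in> X \<Longrightarrow> y \<in> X \<Longrightarrow> \<Psi> (x + y) = \<Psi> x + \<Psi> y"
    and sc: "\<And>c x. x \<in> X \<Longrightarrow> \<Psi> (cscale c x) = c * \<Psi> x"
    using assms(2) unfolding sdual_def by auto
  have X: "ract l b \<in> X" "lact b l \<in> X" for b
    using assms(1,3) unfolding closed_submodule_def by auto
  obtain K where K: "K \<ge> 0" "\<And>m. m \<in> X \<Longrightarrow> cmod (\<Psi> m) \<le> K * norm m"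
    using sdual_bound[OF assms(2)] by blast
  have n: "norm (ract l b) \<le> norm l * norm b" "norm (lact b l) \<le> norm l * norm b" for b
  proof -
    have "norm (blinfun_apply (ract l b) c) \<le> norm l * norm b * norm c" for c
    proof -
      have "norm (blinfun_apply l (b * c)) \<le> norm l * norm (b * c)" by (rule norm_blinfun)
      also have "\<dots> \<le> norm l * (norm b * norm c)" by (intro mult_left_mono norm_mult_ineq) simp
      finally show ?thesis by (simp add: act_apply mult.assoc)
    qed
    then show "norm (ract l b) \<le> norm l * norm b" by (intro norm_blinfun_bound) auto
    have "norm (blinfun_apply (lact b l) c) \<le> norm l * norm b * norm c" for c
    proof -
      have "norm (blinfun_apply l (c * b)) \<le> norm l * norm (c * b)" by (rule norm_blinfun)
      also have "\<dots> \<le> norm l * (norm c * norm b)" by (intro mult_left_mono norm_mult_ineq) simp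
      finally show ?thesis by (simp add: act_apply mult_ac)
    qed
    then show "norm (lact b l) \<le> norm l * norm b" by (intro norm_blinfun_bound) auto
  qed
  have r: "ract l (x + y) = ract l x + ract l y" "ract l (c *\<^sub>R x) = cscale (of_real c) (ract l x)"
    "lact (x + y) l = lact x l + lact y l" "lact (c *\<^sub>R x) l = cscale (of_real c) (lact x l)" for x y c
    by (auto intro!: blinfun_eqI simp: act_apply plus_blinfun.rep_eq distrib_left distrib_right
        blinfun.add_right blinfun.scaleR_right scaleR_conv_of_real)
  have "bounded_linear (\<lambda>a. \<Psi> (ract l a))"
  proof (rule bounded_linear_intro[where K = "K * norm l"])
    fix x show "norm (\<Psi> (ract l x)) \<le> norm x * (K * norm l)"
      using K(2)[OF X(1), of x] mult_left_mono[OF n(1) K(1), of x] by (simp add: mult_ac)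
  qed (simp_all add: r add sc X scaleR_conv_of_real)
  then show "blinfun_apply (dlact \<Psi> l) a = \<Psi> (ract l a)"
    unfolding dlact_def by (simp add: bounded_linear_Blinfun_apply)
  have "bounded_linear (\<lambda>a. \<Psi> (lact a l))"
  proof (rule bounded_linear_intro[where K = "K * norm l"])
    fix x show "norm (\<Psi> (lact x l)) \<le> norm x * (K * norm l)"
      using K(2)[OF X(2), of x] mult_left_mono[OF n(2) K(1), of x] by (simp add: mult_ac)
  qed (simp_all add: r add sc X scaleR_conv_of_real)
  then show "blinfun_apply (dract l \<Psi>) a = \<Psi> (lact a l)"
    unfolding dract_def by (simp add: bounded_linear_Blinfun_apply)
qed

lemma conj_adjoint_apply:
  assumes "bounded_linear \<theta>"
  shows "blinfun_apply (conj_adjoint \<theta> f) a = cnj (blinfun_apply f (\<theta> a))"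
proof -
  have "bounded_linear (\<lambda>a. cnj (blinfun_apply f (\<theta> a)))"
    by (rule bounded_linear_compose[OF bounded_linear_cnj
          bounded_linear_compose[OF blinfun.bounded_linear_right assms]])
  then show ?thesis unfolding conj_adjoint_def by (simp add: bounded_linear_Blinfun_apply)
qed

end

theory Submission
  imports Defs
begin

text \<open>
  Write \<open>\<box>\<close> and \<open>\<diamond>\<close> for the two Arens products. Three facts carry the first part. The map
  \<open>\<Phi> \<mapsto> \<Phi> \<box> \<Psi>\<close> is \<open>w\<^sup>*\<close>-continuous for every \<open>\<Psi>\<close>, and \<open>\<Psi> \<mapsto> \<Phi> \<diamond> \<Psi>\<close> is \<open>w\<^sup>*\<close>-continuous for every
  \<open>\<Phi>\<close>. The products agree as soon as one factor comes from \<open>A\<close>. Finally, the image of \<open>A\<close> is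
  \<open>w\<^sup>*\<close>-dense in \<open>X\<^sup>*\<close>, for a functional in \<open>X\<^sup>*\<close> can be interpolated on finitely many elements of \<open>X\<close>
  by evaluation at a point of \<open>A\<close>. What separates the two products is that each is continuous in one
  variable only, and an anti-homomorphism interchanges the variables. If \<open>\<Theta>\<close> reverses \<open>\<box>\<close>,
  then for fixed \<open>\<Phi>\<close> both \<open>\<Psi> \<mapsto> \<Theta>(\<Phi> \<diamond> \<Psi>)\<close> and \<open>\<Psi> \<mapsto> \<Theta>\<Psi> \<box> \<Theta>\<Phi>\<close> are continuous; they agree on \<open>A\<close>,
  because there \<open>\<Phi> \<diamond> \<Psi> = \<Phi> \<box> \<Psi>\<close>, hence everywhere. So \<open>\<Theta>(\<Phi> \<diamond> \<Psi>) = \<Theta>\<Psi> \<box> \<Theta>\<Phi> = \<Theta>(\<Phi> \<box> \<Psi>)\<close>, and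
  injectivity concludes. The case of \<open>\<diamond>\<close> is symmetric, with \<open>\<Psi>\<close> fixed.

  For the second part, \<open>\<theta>\<^sup>*\<close> interchanges the left and right actions, so that
  \<open>\<theta>\<^sup>*(\<lambda> \<cdot> \<Theta>\<Psi>) = \<Psi> \<cdot> \<theta>\<^sup>*\<lambda>\<close>. Consequently \<open>\<Theta>(\<Phi> \<box> \<Psi>) = \<Theta>\<Psi> \<diamond> \<Theta>\<Phi>\<close>, and this is \<open>\<Theta>\<Psi> \<box> \<Theta>\<Phi>\<close> when the products coincide.
\<close>

section \<open>The spaces X and X*\<close>

lemma closed_submoduleD:
  assumes "closed_submodule X"
  shows "l \<in> X \<Longrightarrow> m \<in> X \<Longrightarrow> l + m \<in> X" "l \<in> X \<Longrightarrow> cscale c l \<in> X"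
    "l \<in> X \<Longrightarrow> ract l a \<in> X" "l \<in> X \<Longrightarrow> lact a l \<in> X"
    "l \<in> X \<Longrightarrow> blinfun_apply l (c *\<^sub>C b) = c * blinfun_apply l b"
  using assms unfolding closed_submodule_def dual_def by auto

lemma sdualD:
  assumes "\<Phi> \<in> sdual X"
  shows "l \<in> X \<Longrightarrow> m \<in> X \<Longrightarrow> \<Phi> (l + m) = \<Phi> l + \<Phi> m" "l \<in> X \<Longrightarrow> \<Phi> (cscale c l) = c * \<Phi> l"
    "\<Phi> \<in> extensional X"
  using assms unfolding sdual_def by auto

lemma sdualI:
  assumes "\<Phi> \<in> extensional X"
    and "\<And>l m. l \<in> X \<Longrightarrow> m \<in> X \<Longrightarrow> \<Phi> (l + m) = \<Phi> l + \<Phi> m"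
    and "\<And>c l. l \<in> X \<Longrightarrow> \<Phi> (cscale c l) = c * \<Phi> l"
    and "\<And>l. l \<in> X \<Longrightarrow> cmod (\<Phi> l) \<le> K * norm l"
  shows "\<Phi> \<in> sdual X"
  using assms unfolding sdual_def by blast

lemma natural_map_in_sdual:
  assumes X: "closed_submodule X"
  shows "natural_map X a \<in> sdual X"
proof (rule sdualI[where K = "norm a"])
  fix l show "l \<in> X \<Longrightarrow> cmod (natural_map X a l) \<le> norm a * norm l"
    using norm_blinfun[of l a] by (simp add: natural_map_def mult.commute)
qed (auto simp: natural_map_def closed_submoduleD[OF X] act_apply plus_blinfun.rep_eq)

lemma norm_ract_le: "norm (ract l a) \<le> norm l * norm a"
proof (rule norm_blinfun_bound)
  fix b
  have "norm (blinfun_apply l (a * b)) \<le> norm l * norm (a * b)" by (rule norm_blinfun)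
  also have "\<dots> \<le> norm l * (norm a * norm b)" by (intro mult_left_mono norm_mult_ineq) simp
  finally show "norm (blinfun_apply (ract l a) b) \<le> norm l * norm a * norm b"
    by (simp add: act_apply mult.assoc)
qed simp

lemma norm_lact_le: "norm (lact a l) \<le> norm l * norm a"
proof (rule norm_blinfun_bound)
  fix b
  have "norm (blinfun_apply l (b * a)) \<le> norm l * norm (b * a)" by (rule norm_blinfun)
  also have "\<dots> \<le> norm l * (norm b * norm a)" by (intro mult_left_mono norm_mult_ineq) simp
  finally show "norm (blinfun_apply (lact a l) b) \<le> norm l * norm a * norm b"
    by (simp add: act_apply mult_ac)
qed simp

lemma act_linear:
  "ract (l + m) a = ract l a + ract m a" "ract (cscale c l) a = cscale c (ract l a)"
  "lact a (l + m) = lact a l + lact a m" "lact a (cscale c l) = cscale c (lact a l)"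
  by (auto intro!: blinfun_eqI simp: act_apply plus_blinfun.rep_eq)

lemma dual_act_linear:
  assumes X: "closed_submodule X" and \<Psi>: "\<Psi> \<in> sdual X" and "l \<in> X" "m \<in> X"
  shows "dlact \<Psi> (l + m) = dlact \<Psi> l + dlact \<Psi> m" "dlact \<Psi> (cscale c l) = cscale c (dlact \<Psi> l)"
    "dract (l + m) \<Psi> = dract l \<Psi> + dract m \<Psi>" "dract (cscale c l) \<Psi> = cscale c (dract l \<Psi>)"
  using assms(3,4)
  by (auto intro!: blinfun_eqI simp: dual_act_apply[OF X \<Psi>] closed_submoduleD[OF X] sdualD[OF \<Psi>]
      act_linear act_apply plus_blinfun.rep_eq)

lemma dual_act_bound:
  assumes X: "closed_submodule X" and \<Psi>: "\<Psi> \<in> sdual X"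
  shows "\<exists>K. \<forall>l\<in>X. norm (dlact \<Psi> l) \<le> K * norm l \<and> norm (dract l \<Psi>) \<le> K * norm l"
proof -
  obtain K where K: "K \<ge> 0" "\<And>l. l \<in> X \<Longrightarrow> cmod (\<Psi> l) \<le> K * norm l"
    using sdual_bound[OF \<Psi>] by blast
  show ?thesis
  proof (intro exI ballI conjI)
    fix l assume l: "l \<in> X"
    show "norm (dlact \<Psi> l) \<le> K * norm l"
    proof (rule norm_blinfun_bound)
      fix a show "norm (blinfun_apply (dlact \<Psi> l) a) \<le> K * norm l * norm a"
        using K(2)[OF closed_submoduleD(3)[OF X l], of a]
          mult_left_mono[OF norm_ract_le[of l a] K(1)]
        by (simp add: dual_act_apply[OF X \<Psi> l] mult.assoc)
    qed (simp add: K)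
    show "norm (dract l \<Psi>) \<le> K * norm l"
    proof (rule norm_blinfun_bound)
      fix a show "norm (blinfun_apply (dract l \<Psi>) a) \<le> K * norm l * norm a"
        using K(2)[OF closed_submoduleD(4)[OF X l], of a]
          mult_left_mono[OF norm_lact_le[of a l] K(1)]
        by (simp add: dual_act_apply[OF X \<Psi> l] mult.assoc)
    qed (simp add: K)
  qed
qed

section \<open>The Arens products\<close>

lemma sdual_comp_bounded:
  assumes X: "closed_submodule X" and \<Phi>: "\<Phi> \<in> sdual X"
    and T: "\<And>l. l \<in> X \<Longrightarrow> T l \<in> X"
    and add: "\<And>l m. l \<in> X \<Longrightarrow> m \<in> X \<Longrightarrow> T (l + m) = T l + T m"
    and scale: "\<And>c l. l \<in> X \<Longrightarrow> T (cscale c l) = cscale c (T l)"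
    and bound: "\<And>l. l \<in> X \<Longrightarrow> norm (T l) \<le> K * norm l"
  shows "(\<lambda>l\<in>X. \<Phi> (T l)) \<in> sdual X"
proof -
  obtain M where M: "M \<ge> 0" "\<And>l. l \<in> X \<Longrightarrow> cmod (\<Phi> l) \<le> M * norm l"
    using sdual_bound[OF \<Phi>] by blast
  show ?thesis
  proof (rule sdualI[where K = "M * K"])
    fix l assume l: "l \<in> X"
    show "cmod ((\<lambda>l\<in>X. \<Phi> (T l)) l) \<le> M * K * norm l"
      using M(2)[OF T[OF l]] mult_left_mono[OF bound[OF l] M(1)] l by (simp add: mult.assoc)
  qed (simp_all add: T add scale closed_submoduleD[OF X] sdualD[OF \<Phi>])
qed

lemma arens_in_sdual:
  assumes X: "closed_submodule X" and I: "topologically_introverted X"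
    and \<Phi>: "\<Phi> \<in> sdual X" and \<Psi>: "\<Psi> \<in> sdual X"
  shows "arens1 X \<Phi> \<Psi> \<in> sdual X" "arens2 X \<Phi> \<Psi> \<in> sdual X"
proof -
  have T: "dlact \<Psi> l \<in> X" "dract l \<Phi> \<in> X" if "l \<in> X" for l
    using I \<Phi> \<Psi> that unfolding topologically_introverted_def topologically_left_introverted_def
      topologically_right_introverted_def by auto
  obtain K where K: "\<forall>l\<in>X. norm (dlact \<Psi> l) \<le> K * norm l \<and> norm (dract l \<Psi>) \<le> K * norm l"
    using dual_act_bound[OF X \<Psi>] by blast
  show "arens1 X \<Phi> \<Psi> \<in> sdual X" unfolding arens1_def
    by (rule sdual_comp_bounded[OF X \<Phi>, where K = K]) (simp_all add: K T dual_act_linear[OF X \<Psi>])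
  obtain L where L: "\<forall>l\<in>X. norm (dlact \<Phi> l) \<le> L * norm l \<and> norm (dract l \<Phi>) \<le> L * norm l"
    using dual_act_bound[OF X \<Phi>] by blast
  show "arens2 X \<Phi> \<Psi> \<in> sdual X" unfolding arens2_def
    by (rule sdual_comp_bounded[OF X \<Psi>, where K = L]) (simp_all add: L T dual_act_linear[OF X \<Phi>])
qed

text \<open>
  Acting by the image of \<open>a\<close> is acting by \<open>a\<close> itself, so with a factor from \<open>A\<close> both products
  reduce to evaluating the other factor at \<open>\<lambda> \<cdot> a\<close> or at \<open>a \<cdot> \<lambda>\<close>.
\<close>

lemma arens_natural_map:
  assumes X: "closed_submodule X" and I: "topologically_introverted X" and \<Phi>: "\<Phi> \<in> sdual X"
  shows "arens1 X (natural_map X a) \<Phi> = arens2 X (natural_map X a) \<Phi>"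
    and "arens1 X \<Phi> (natural_map X a) = arens2 X \<Phi> (natural_map X a)"
proof -
  note N = natural_map_in_sdual[OF X, of a]
  note sub = closed_submoduleD(3,4)[OF X]
  have ev: "natural_map X a m = blinfun_apply m a" if "m \<in> X" for m
    using that by (simp add: natural_map_def)
  have left: "dlact (natural_map X a) l = lact a l"
    and right: "dract l (natural_map X a) = ract l a" if l: "l \<in> X" for l
    by (auto intro!: blinfun_eqI simp: dual_act_apply[OF X N l] ev sub[OF l] act_apply)
  have mem: "dlact \<Phi> l \<in> X" "dract l \<Phi> \<in> X" if "l \<in> X" for l
    using I \<Phi> that unfolding topologically_introverted_def topologically_left_introverted_def
      topologically_right_introverted_def by auto
  show "arens1 X (natural_map X a) \<Phi> = arens2 X (natural_map X a) \<Phi>"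
    unfolding arens1_def arens2_def
    by (rule restrict_ext) (simp add: ev mem right dual_act_apply[OF X \<Phi>])
  show "arens1 X \<Phi> (natural_map X a) = arens2 X \<Phi> (natural_map X a)"
    unfolding arens1_def arens2_def
    by (rule restrict_ext) (simp add: ev mem left dual_act_apply[OF X \<Phi>])
qed

section \<open>The weak-star topology\<close>

lemma topspace_weak_star: "topspace (weak_star X) = sdual X"
  unfolding weak_star_def sdual_def by (auto simp: PiE_def)

lemma Hausdorff_weak_star: "Hausdorff_space (weak_star X)"
  unfolding weak_star_def
  by (intro Hausdorff_space_subtopology) (simp add: Hausdorff_space_product_topology)

lemma continuous_map_weak_star_eval:
  "l \<in> X \<Longrightarrow> continuous_map (weak_star X) euclidean (\<lambda>\<Phi>. \<Phi> l)"
  unfolding weak_star_def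
  by (intro continuous_map_from_subtopology continuous_map_product_projection)

lemma continuous_map_into_weak_star:
  assumes "\<And>x. x \<in> topspace S \<Longrightarrow> f x \<in> sdual X"
    and "\<And>l. l \<in> X \<Longrightarrow> continuous_map S euclidean (\<lambda>x. f x l)"
  shows "continuous_map S (weak_star X) f"
  using assms sdualD(3) unfolding weak_star_def
  by (auto simp: continuous_map_in_subtopology continuous_map_componentwise)

lemma continuous_map_arens1:
  assumes X: "closed_submodule X" and I: "topologically_introverted X" and \<Psi>: "\<Psi> \<in> sdual X"
  shows "continuous_map (weak_star X) (weak_star X) (\<lambda>\<Phi>. arens1 X \<Phi> \<Psi>)"
proof (rule continuous_map_into_weak_star)
  fix l assume l: "l \<in> X"
  then have "dlact \<Psi> l \<in> X"
    using I \<Psi> unfolding topologically_introverted_def topologically_left_introverted_def by blast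
  then show "continuous_map (weak_star X) euclidean (\<lambda>\<Phi>. arens1 X \<Phi> \<Psi> l)"
    using l by (simp add: arens1_def continuous_map_weak_star_eval)
qed (simp add: topspace_weak_star arens_in_sdual[OF X I _ \<Psi>])

lemma continuous_map_arens2:
  assumes X: "closed_submodule X" and I: "topologically_introverted X" and \<Phi>: "\<Phi> \<in> sdual X"
  shows "continuous_map (weak_star X) (weak_star X) (\<lambda>\<Psi>. arens2 X \<Phi> \<Psi>)"
proof (rule continuous_map_into_weak_star)
  fix l assume l: "l \<in> X"
  then have "dract l \<Phi> \<in> X"
    using I \<Phi> unfolding topologically_introverted_def topologically_right_introverted_def by blast
  then show "continuous_map (weak_star X) euclidean (\<lambda>\<Psi>. arens2 X \<Phi> \<Psi> l)"
    using l by (simp add: arens2_def continuous_map_weak_star_eval)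
qed (simp add: topspace_weak_star arens_in_sdual[OF X I \<Phi>])

section \<open>Density of A in X*\<close>

text \<open>
  A functional that vanishes on the common kernel of finitely many others is a linear combination
  of them, so the value of \<open>\<Phi>\<close> at it is determined by the values at the others. In the induction step,
  take \<open>b\<close> in the common kernel of \<open>F\<close> with \<open>\<nu> b = 1\<close>; then \<open>\<mu> - (\<mu> b) \<nu>\<close> vanishes on the common
  kernel of \<open>F\<close> alone.
\<close>

lemma eval_agree_on_kernel:
  assumes X: "closed_submodule X" and \<Phi>: "\<Phi> \<in> sdual X"
    and "finite F" "F \<subseteq> X" "\<And>l. l \<in> F \<Longrightarrow> \<Phi> l = blinfun_apply l a"
    and "\<mu> \<in> X" "\<And>x. (\<And>l. l \<in> F \<Longrightarrow> blinfun_apply l x = 0) \<Longrightarrow> blinfun_apply \<mu> x = 0"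
  shows "\<Phi> \<mu> = blinfun_apply \<mu> a"
  using assms(3-)
proof (induction F arbitrary: \<mu>)
  case empty
  \<comment> \<open>The common kernel of no functionals is all of \<open>A\<close>, so \<open>\<mu> = 0\<close>.\<close>
  then have "cscale 0 \<mu> = \<mu>" by (intro blinfun_eqI) (simp add: act_apply)
  then have "\<Phi> \<mu> = 0" using sdualD(2)[OF \<Phi> \<open>\<mu> \<in> X\<close>, of 0] by simp
  then show ?case using empty by simp
next
  case (insert \<nu> F)
  have \<nu>: "\<nu> \<in> X" using insert.prems by simp
  show ?case
  proof (cases "\<exists>b. (\<forall>l\<in>F. blinfun_apply l b = 0) \<and> blinfun_apply \<nu> b \<noteq> 0")
    case False
    then have "\<And>x. (\<And>l. l \<in> F \<Longrightarrow> blinfun_apply l x = 0) \<Longrightarrow> blinfun_apply \<mu> x = 0"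
      using insert.prems(4) by blast
    then show ?thesis using insert.IH insert.prems by simp
  next
    case True
    then obtain b0 where b0: "\<And>l. l \<in> F \<Longrightarrow> blinfun_apply l b0 = 0" "blinfun_apply \<nu> b0 \<noteq> 0"
      by blast
    define b where "b = (1 / blinfun_apply \<nu> b0) *\<^sub>C b0"
    have b: "\<And>l. l \<in> F \<Longrightarrow> blinfun_apply l b = 0" "blinfun_apply \<nu> b = 1"
      using b0 insert.prems(1) by (auto simp: b_def closed_submoduleD(5)[OF X])
    define \<mu>' where "\<mu>' = \<mu> + cscale (- blinfun_apply \<mu> b) \<nu>"
    have \<mu>': "\<mu>' \<in> X" using \<nu> insert.prems(3) by (simp add: \<mu>'_def closed_submoduleD[OF X])
    have ev: "blinfun_apply \<mu>' x = blinfun_apply \<mu> x - blinfun_apply \<mu> b * blinfun_apply \<nu> x" for x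
      by (simp add: \<mu>'_def act_apply plus_blinfun.rep_eq)
    have "\<Phi> \<mu>' = blinfun_apply \<mu>' a"
    proof (rule insert.IH[OF _ _ \<mu>'])
      fix x assume x: "\<And>l. l \<in> F \<Longrightarrow> blinfun_apply l x = 0"
      have "blinfun_apply \<mu> (x - blinfun_apply \<nu> x *\<^sub>C b) = 0"
      proof (rule insert.prems(4))
        fix l assume "l \<in> insert \<nu> F"
        moreover have "l \<in> X" using calculation insert.prems(1) by blast
        ultimately show "blinfun_apply l (x - blinfun_apply \<nu> x *\<^sub>C b) = 0"
          using x b by (auto simp: blinfun.diff_right closed_submoduleD(5)[OF X])
      qed
      then show "blinfun_apply \<mu>' x = 0"
        using insert.prems(3) by (simp add: ev blinfun.diff_right closed_submoduleD(5)[OF X])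
    qed (use insert.prems in auto)
    moreover have "\<Phi> \<mu>' = \<Phi> \<mu> - blinfun_apply \<mu> b * \<Phi> \<nu>"
      using \<nu> insert.prems(3) by (simp add: \<mu>'_def sdualD[OF \<Phi>] closed_submoduleD[OF X])
    ultimately show ?thesis using insert.prems(2) by (simp add: ev)
  qed
qed

text \<open>
  When a functional \<open>\<mu>\<close> joins the list, there are two cases. Either \<open>\<mu>\<close> is nonzero somewhere on the
  common kernel of the old ones, and a multiple of such a point corrects the value at \<open>\<mu>\<close> without
  affecting the old values, or the value of \<open>\<Phi>\<close> at \<open>\<mu>\<close> is forced by the old ones.
\<close>

lemma interpolation_by_eval:
  assumes X: "closed_submodule X" and \<Phi>: "\<Phi> \<in> sdual X" and "finite F" "F \<subseteq> X"
  shows "\<exists>a. \<forall>l\<in>F. \<Phi> l = blinfun_apply l a"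
  using assms(3,4)
proof (induction F)
  case empty
  then show ?case by simp
next
  case (insert \<mu> F)
  then obtain a where a: "\<And>l. l \<in> F \<Longrightarrow> \<Phi> l = blinfun_apply l a" by auto
  have \<mu>: "\<mu> \<in> X" and F: "F \<subseteq> X" using insert.prems by auto
  show ?case
  proof (cases "\<exists>b. (\<forall>l\<in>F. blinfun_apply l b = 0) \<and> blinfun_apply \<mu> b \<noteq> 0")
    case False
    then have "\<Phi> \<mu> = blinfun_apply \<mu> a"
      using eval_agree_on_kernel[OF X \<Phi> insert.hyps(1) F a \<mu>] by blast
    then show ?thesis using a by auto
  next
    case True
    then obtain b where b: "\<And>l. l \<in> F \<Longrightarrow> blinfun_apply l b = 0" "blinfun_apply \<mu> b \<noteq> 0"
      by blast
    have "\<Phi> l = blinfun_apply l (a + ((\<Phi> \<mu> - blinfun_apply \<mu> a) / blinfun_apply \<mu> b) *\<^sub>C b)"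
      if l: "l \<in> insert \<mu> F" for l
      using a b l F \<mu> by (auto simp: blinfun.add_right closed_submoduleD(5)[OF X] subset_iff)
    then show ?thesis by blast
  qed
qed

lemma natural_map_weak_star_dense:
  assumes X: "closed_submodule X"
  shows "(weak_star X) closure_of (range (natural_map X)) = sdual X"
proof (rule antisym)
  show "(weak_star X) closure_of (range (natural_map X)) \<subseteq> sdual X"
    using closure_of_subset_topspace[of "weak_star X"] by (simp add: topspace_weak_star)
  show "sdual X \<subseteq> (weak_star X) closure_of (range (natural_map X))"
  proof
    fix \<Phi> assume \<Phi>: "\<Phi> \<in> sdual X"
    have "\<exists>\<Psi>. \<Psi> \<in> range (natural_map X) \<and> \<Psi> \<in> T" if T: "\<Phi> \<in> T" "openin (weak_star X) T" for T
    proof -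
      obtain U where U: "openin (product_topology (\<lambda>_. euclidean) X) U" "T = U \<inter> sdual X"
        using T(2) unfolding weak_star_def openin_subtopology by blast
      have "\<Phi> \<in> U" using T(1) U(2) by blast
      then obtain V where V: "finite {l \<in> X. V l \<noteq> UNIV}" "\<Phi> \<in> Pi\<^sub>E X V" "Pi\<^sub>E X V \<subseteq> U"
        using U(1) unfolding openin_product_topology_alt topspace_euclidean by blast
      obtain a where a: "\<And>l. l \<in> X \<Longrightarrow> V l \<noteq> UNIV \<Longrightarrow> \<Phi> l = blinfun_apply l a"
        using interpolation_by_eval[OF X \<Phi> V(1)] by auto
      have "natural_map X a l \<in> V l" if l: "l \<in> X" for l
      proof (cases "V l = UNIV")
        case False
        then show ?thesis using a[OF l] PiE_mem[OF V(2) l] l by (simp add: natural_map_def)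
      qed simp
      then have "natural_map X a \<in> Pi\<^sub>E X V" by (auto simp: natural_map_def)
      then show ?thesis using U V natural_map_in_sdual[OF X] by blast
    qed
    then show "\<Phi> \<in> (weak_star X) closure_of (range (natural_map X))"
      using \<Phi> by (simp add: in_closure_of topspace_weak_star)
  qed
qed

lemma weak_star_continuous_eqI:
  assumes X: "closed_submodule X"
    and "continuous_map (weak_star X) (weak_star X) f" "continuous_map (weak_star X) (weak_star X) g"
    and "\<And>a. f (natural_map X a) = g (natural_map X a)" and "\<Phi> \<in> sdual X"
  shows "f \<Phi> = g \<Phi>"
  by (rule forall_in_closure_of_eq[OF _ Hausdorff_weak_star assms(2,3),
        where S = "range (natural_map X)"])
    (use assms natural_map_weak_star_dense[OF X] in auto)

section \<open>Anti-homomorphisms force the products to coincide\<close>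

lemma arens_products_coincide_of_anti_hom1:
  assumes X: "closed_submodule X" and I: "topologically_introverted X"
    and cont: "continuous_map (weak_star X) (weak_star X) \<Theta>" and inj: "inj_on \<Theta> (sdual X)"
    and anti: "anti_hom_on (sdual X) (arens1 X) \<Theta>"
  shows "arens_products_coincide X"
  unfolding arens_products_coincide_def
proof (intro ballI)
  fix \<Phi> \<Psi> assume \<Phi>: "\<Phi> \<in> sdual X" and \<Psi>: "\<Psi> \<in> sdual X"
  note N = natural_map_in_sdual[OF X]
  have \<Theta>: "\<Theta> \<Phi> \<in> sdual X"
    and rev: "\<And>\<Psi>. \<Psi> \<in> sdual X \<Longrightarrow> \<Theta> (arens1 X \<Phi> \<Psi>) = arens1 X (\<Theta> \<Psi>) (\<Theta> \<Phi>)"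
    using anti \<Phi> unfolding anti_hom_on_def by auto
  have "\<Theta> (arens2 X \<Phi> \<Psi>) = arens1 X (\<Theta> \<Psi>) (\<Theta> \<Phi>)"
  proof (rule weak_star_continuous_eqI[OF X _ _ _ \<Psi>])
    show "continuous_map (weak_star X) (weak_star X) (\<lambda>\<Psi>. \<Theta> (arens2 X \<Phi> \<Psi>))"
      using continuous_map_compose[OF continuous_map_arens2[OF X I \<Phi>] cont] by (simp add: o_def)
    show "continuous_map (weak_star X) (weak_star X) (\<lambda>\<Psi>. arens1 X (\<Theta> \<Psi>) (\<Theta> \<Phi>))"
      using continuous_map_compose[OF cont continuous_map_arens1[OF X I \<Theta>]] by (simp add: o_def)
    show "\<Theta> (arens2 X \<Phi> (natural_map X a)) = arens1 X (\<Theta> (natural_map X a)) (\<Theta> \<Phi>)" for a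
      using rev[OF N] arens_natural_map(2)[OF X I \<Phi>] by simp
  qed
  then show "arens1 X \<Phi> \<Psi> = arens2 X \<Phi> \<Psi>"
    using inj_onD[OF inj] rev[OF \<Psi>] arens_in_sdual[OF X I \<Phi> \<Psi>] by simp
qed

lemma arens_products_coincide_of_anti_hom2:
  assumes X: "closed_submodule X" and I: "topologically_introverted X"
    and cont: "continuous_map (weak_star X) (weak_star X) \<Theta>" and inj: "inj_on \<Theta> (sdual X)"
    and anti: "anti_hom_on (sdual X) (arens2 X) \<Theta>"
  shows "arens_products_coincide X"
  unfolding arens_products_coincide_def
proof (intro ballI)
  fix \<Phi> \<Psi> assume \<Phi>: "\<Phi> \<in> sdual X" and \<Psi>: "\<Psi> \<in> sdual X"
  note N = natural_map_in_sdual[OF X]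
  have \<Theta>: "\<Theta> \<Psi> \<in> sdual X"
    and rev: "\<And>\<Phi>. \<Phi> \<in> sdual X \<Longrightarrow> \<Theta> (arens2 X \<Phi> \<Psi>) = arens2 X (\<Theta> \<Psi>) (\<Theta> \<Phi>)"
    using anti \<Psi> unfolding anti_hom_on_def by auto
  have "\<Theta> (arens1 X \<Phi> \<Psi>) = arens2 X (\<Theta> \<Psi>) (\<Theta> \<Phi>)"
  proof (rule weak_star_continuous_eqI[OF X _ _ _ \<Phi>])
    show "continuous_map (weak_star X) (weak_star X) (\<lambda>\<Phi>. \<Theta> (arens1 X \<Phi> \<Psi>))"
      using continuous_map_compose[OF continuous_map_arens1[OF X I \<Psi>] cont] by (simp add: o_def)
    show "continuous_map (weak_star X) (weak_star X) (\<lambda>\<Phi>. arens2 X (\<Theta> \<Psi>) (\<Theta> \<Phi>))"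
      using continuous_map_compose[OF cont continuous_map_arens2[OF X I \<Theta>]] by (simp add: o_def)
    show "\<Theta> (arens1 X (natural_map X a) \<Psi>) = arens2 X (\<Theta> \<Psi>) (\<Theta> (natural_map X a))" for a
      using rev[OF N] arens_natural_map(1)[OF X I \<Psi>] by simp
  qed
  then show "arens1 X \<Phi> \<Psi> = arens2 X \<Phi> \<Psi>"
    using inj_onD[OF inj] rev[OF \<Phi>] arens_in_sdual[OF X I \<Phi> \<Psi>] by simp
qed

section \<open>Extending an involution\<close>

lemma conj_adjoint_linear:
  assumes "bounded_linear \<theta>"
  shows "conj_adjoint \<theta> (l + m) = conj_adjoint \<theta> l + conj_adjoint \<theta> m"
    and "conj_adjoint \<theta> (cscale c l) = cscale (cnj c) (conj_adjoint \<theta> l)"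
  by (auto intro!: blinfun_eqI simp: conj_adjoint_apply[OF assms] plus_blinfun.rep_eq act_apply)

lemma norm_conj_adjoint_le:
  assumes "bounded_linear \<theta>"
  shows "norm (conj_adjoint \<theta> l) \<le> onorm \<theta> * norm l"
proof (rule norm_blinfun_bound)
  fix a
  have "norm (blinfun_apply l (\<theta> a)) \<le> norm l * norm (\<theta> a)" by (rule norm_blinfun)
  also have "\<dots> \<le> norm l * (onorm \<theta> * norm a)" by (intro mult_left_mono onorm assms) simp
  finally show "norm (blinfun_apply (conj_adjoint \<theta> l) a) \<le> onorm \<theta> * norm l * norm a"
    by (simp add: conj_adjoint_apply[OF assms] mult_ac)
qed (simp add: onorm_pos_le[OF assms])

lemma conj_adjoint_restr_in_sdual:
  assumes X: "closed_submodule X" and bl: "bounded_linear \<theta>" and sub: "conj_adjoint \<theta> ` X \<subseteq> X"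
    and \<Phi>: "\<Phi> \<in> sdual X"
  shows "conj_adjoint_restr X (conj_adjoint \<theta>) \<Phi> \<in> sdual X"
proof -
  obtain M where M: "M \<ge> 0" "\<And>l. l \<in> X \<Longrightarrow> cmod (\<Phi> l) \<le> M * norm l"
    using sdual_bound[OF \<Phi>] by blast
  have T: "conj_adjoint \<theta> l \<in> X" if "l \<in> X" for l using sub that by blast
  show ?thesis
  proof (rule sdualI[where K = "M * onorm \<theta>"])
    fix l assume l: "l \<in> X"
    show "cmod (conj_adjoint_restr X (conj_adjoint \<theta>) \<Phi> l) \<le> M * onorm \<theta> * norm l"
      using M(2)[OF T[OF l]] mult_left_mono[OF norm_conj_adjoint_le[OF bl, of l] M(1)] l
      by (simp add: conj_adjoint_restr_def mult.assoc)
  qed (simp_all add: conj_adjoint_restr_def T conj_adjoint_linear[OF bl] closed_submoduleD[OF X]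
      sdualD[OF \<Phi>])
qed

text \<open>Since \<open>\<theta>\<close> reverses products, \<open>\<theta>\<^sup>*\<close> turns the left action of \<open>\<theta> a\<close> into the right action of \<open>a\<close>.\<close>

lemma conj_adjoint_lact:
  assumes "bounded_linear \<theta>" and "\<And>a b. \<theta> (a * b) = \<theta> b * \<theta> a"
  shows "conj_adjoint \<theta> (lact (\<theta> a) l) = ract (conj_adjoint \<theta> l) a"
  by (rule blinfun_eqI) (simp add: conj_adjoint_apply[OF assms(1)] act_apply assms(2))

lemma conj_adjoint_dract:
  assumes X: "closed_submodule X" and bl: "bounded_linear \<theta>" and sub: "conj_adjoint \<theta> ` X \<subseteq> X"
    and rev: "\<And>a b. \<theta> (a * b) = \<theta> b * \<theta> a" and \<Psi>: "\<Psi> \<in> sdual X" and l: "l \<in> X"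
  shows "conj_adjoint \<theta> (dract l (conj_adjoint_restr X (conj_adjoint \<theta>) \<Psi>)) =
    dlact \<Psi> (conj_adjoint \<theta> l)"
proof (rule blinfun_eqI)
  fix a
  let ?\<Theta> = "conj_adjoint_restr X (conj_adjoint \<theta>)"
  have "conj_adjoint \<theta> l \<in> X" using sub l by blast
  moreover have "?\<Theta> \<Psi> (lact (\<theta> a) l) = cnj (\<Psi> (ract (conj_adjoint \<theta> l) a))"
    using closed_submoduleD(4)[OF X l]
    by (simp add: conj_adjoint_restr_def conj_adjoint_lact[OF bl rev])
  ultimately show "blinfun_apply (conj_adjoint \<theta> (dract l (?\<Theta> \<Psi>))) a =
      blinfun_apply (dlact \<Psi> (conj_adjoint \<theta> l)) a"
    by (simp add: conj_adjoint_apply[OF bl] dual_act_apply[OF X \<Psi>]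
        dual_act_apply[OF X conj_adjoint_restr_in_sdual[OF X bl sub \<Psi>] l])
qed

text \<open>
  Because \<open>\<theta>\<^sup>*\<close> interchanges the two actions, its adjoint carries one Arens product to the opposite
  of the other; it reverses \<open>\<box>\<close> itself exactly when the products agree on the images.
\<close>

lemma conj_adjoint_restr_arens:
  assumes X: "closed_submodule X" and I: "topologically_introverted X"
    and bl: "bounded_linear \<theta>" and sub: "conj_adjoint \<theta> ` X \<subseteq> X"
    and rev: "\<And>a b. \<theta> (a * b) = \<theta> b * \<theta> a" and \<Phi>: "\<Phi> \<in> sdual X" and \<Psi>: "\<Psi> \<in> sdual X"
  shows "conj_adjoint_restr X (conj_adjoint \<theta>) (arens1 X \<Phi> \<Psi>) =
    arens2 X (conj_adjoint_restr X (conj_adjoint \<theta>) \<Psi>) (conj_adjoint_restr X (conj_adjoint \<theta>) \<Phi>)"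
proof (rule extensionalityI[where A = X])
  let ?\<Theta> = "conj_adjoint_restr X (conj_adjoint \<theta>)"
  fix l assume l: "l \<in> X"
  then have "conj_adjoint \<theta> l \<in> X" using sub by blast
  moreover have "dract l (?\<Theta> \<Psi>) \<in> X"
    using I l conj_adjoint_restr_in_sdual[OF X bl sub \<Psi>]
    unfolding topologically_introverted_def topologically_right_introverted_def by blast
  ultimately show "?\<Theta> (arens1 X \<Phi> \<Psi>) l = arens2 X (?\<Theta> \<Psi>) (?\<Theta> \<Phi>) l"
    using l conj_adjoint_dract[OF X bl sub rev \<Psi> l]
    by (simp add: arens1_def arens2_def conj_adjoint_restr_def)
qed (simp_all add: conj_adjoint_restr_def arens2_def)

lemma conj_adjoint_involutive:
  assumes "bounded_linear \<theta>" "\<And>a. \<theta> (\<theta> a) = a"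
  shows "conj_adjoint \<theta> (conj_adjoint \<theta> l) = l"
  by (rule blinfun_eqI) (simp add: conj_adjoint_apply[OF assms(1)] assms(2))

lemma involution_on_conj_adjoint_restr:
  assumes X: "closed_submodule X" and I: "topologically_introverted X"
    and bl: "bounded_linear \<theta>" and sub: "conj_adjoint \<theta> ` X \<subseteq> X"
    and inv: "involution_on UNIV (+) scaleC (*) \<theta>" and coin: "arens_products_coincide X"
  shows "involution_on (sdual X) (sdual_add X) (sdual_scale X) (arens1 X)
    (conj_adjoint_restr X (conj_adjoint \<theta>))"
    (is "involution_on _ _ _ _ ?\<Theta>")
proof -
  have rev: "\<And>a b. \<theta> (a * b) = \<theta> b * \<theta> a" and invol: "\<And>a. \<theta> (\<theta> a) = a"
    using inv unfolding involution_on_def anti_hom_on_def by auto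
  note S = conj_adjoint_restr_in_sdual[OF X bl sub]
  have T: "conj_adjoint \<theta> l \<in> X" if "l \<in> X" for l using sub that by blast
  have "?\<Theta> (arens1 X \<Phi> \<Psi>) = arens1 X (?\<Theta> \<Psi>) (?\<Theta> \<Phi>)" if "\<Phi> \<in> sdual X" "\<Psi> \<in> sdual X" for \<Phi> \<Psi>
    using conj_adjoint_restr_arens[OF X I bl sub rev that] coin S that
    unfolding arens_products_coincide_def by simp
  moreover have "?\<Theta> (sdual_add X \<Phi> \<Psi>) = sdual_add X (?\<Theta> \<Phi>) (?\<Theta> \<Psi>)"
    "?\<Theta> (sdual_scale X c \<Phi>) = sdual_scale X (cnj c) (?\<Theta> \<Phi>)" for \<Phi> \<Psi> c
    by (auto intro!: restrict_ext simp: conj_adjoint_restr_def sdual_add_def sdual_scale_def T)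
  moreover have "?\<Theta> (?\<Theta> \<Phi>) = \<Phi>" if "\<Phi> \<in> sdual X" for \<Phi>
    by (rule extensionalityI[where A = X])
      (use that in \<open>simp_all add: conj_adjoint_restr_def T conj_adjoint_involutive[OF bl invol]
        sdualD(3)\<close>)
  ultimately show ?thesis using S unfolding involution_on_def anti_hom_on_def by auto
qed

lemma conj_adjoint_restr_natural_map:
  assumes "bounded_linear \<theta>" "conj_adjoint \<theta> ` X \<subseteq> X"
  shows "conj_adjoint_restr X (conj_adjoint \<theta>) (natural_map X a) = natural_map X (\<theta> a)"
  using assms(2) unfolding conj_adjoint_restr_def natural_map_def
  by (auto intro!: restrict_ext simp: conj_adjoint_apply[OF assms(1)])

theorem theorem3p1:
  fixes X :: "('a::complex_banach_algebra \<Rightarrow>\<^sub>L complex) set"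
  assumes "closed_submodule X" and "faithful X" and "topologically_introverted X"
  shows
    "((\<exists>\<Theta>. continuous_map (weak_star X) (weak_star X) \<Theta> \<and> inj_on \<Theta> (sdual X) \<and>
           (anti_hom_on (sdual X) (arens1 X) \<Theta> \<or> anti_hom_on (sdual X) (arens2 X) \<Theta>) \<and>
           \<Theta> ` range (natural_map X) \<subseteq> range (natural_map X))
        \<longrightarrow> arens_products_coincide X)
     \<and>
     (\<forall>\<theta> :: 'a \<Rightarrow> 'a.
        involution_on UNIV (+) scaleC (*) \<theta> \<and> bounded_linear \<theta> \<and>
        conj_adjoint \<theta> ` X \<subseteq> X \<and> arens_products_coincide X
        \<longrightarrow> involution_on (sdual X) (sdual_add X) (sdual_scale X) (arens1 X)
              (conj_adjoint_restr X (conj_adjoint \<theta>)) \<and>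
            (\<forall>a. conj_adjoint_restr X (conj_adjoint \<theta>) (natural_map X a) = natural_map X (\<theta> a)))"
proof (intro conjI impI allI)
  assume "\<exists>\<Theta>. continuous_map (weak_star X) (weak_star X) \<Theta> \<and> inj_on \<Theta> (sdual X) \<and>
      (anti_hom_on (sdual X) (arens1 X) \<Theta> \<or> anti_hom_on (sdual X) (arens2 X) \<Theta>) \<and>
      \<Theta> ` range (natural_map X) \<subseteq> range (natural_map X)"
  then show "arens_products_coincide X"
    using arens_products_coincide_of_anti_hom1[OF assms(1,3)]
      arens_products_coincide_of_anti_hom2[OF assms(1,3)] by blast
qed (use involution_on_conj_adjoint_restr[OF assms(1,3)] conj_adjoint_restr_natural_map in blast)+

end
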